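(* Assume that the weight distribution has polynomial left tails, i.e. there are $p,\rho>0$ and $b>0$ such that $F(w)=p\,w^\rho$ for all $0<w\le b$. Let $k\ge0$, let $v_s=v_{s,k}$ be the scaling parameter defined in the context, and let $\sigma_s:=s v_s$. Then $$\lim_{s\uparrow\infty}\frac{\sigma_s^\rho}{s}=\frac{p\,\rho}{k!\,\mu_a^\rho}\,\Gamma(k+\rho),$$ where $\mu_a=\mathbb E[W^a]$ and $\Gamma$ is the Gamma function.
   Context: Let $a\ge0$ and $\alpha>1$. The weight $W$ is a random variable on $(0,\infty)$ with distribution function $F$, where $1-F$ is regularly varying at infinity with tail index $\beta>a\alpha$ (i.e. $1-F(w)=w^{-\beta}\ell(w)$, $\ell$ slowly varying); in particular $\mu_{a\alpha}<\infty$, where $\mu_r:=\mathbb E[W^r]$. Let $h(w):=w\,\mathbb E[\mathbf 1\{W\ge w\}W^a]+w^a\,\mathbb E[\mathbf 1\{W<w\}W]$. The parameter $v_{s,k}$ is the largest solution $v$ of $k!=s\,\mathbb E\big[(s v\,h(W))^k\exp(-s v\,h(W))\big]$ (it exists for all sufficiently large $s$). *)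

theory Defs
  imports "HOL-Probability.Probability"
begin

definition slowly_varying :: "(real \<Rightarrow> real) \<Rightarrow> bool" where
  "slowly_varying l \<longleftrightarrow>
     (\<exists>x0. (\<forall>x\<ge>x0. 0 < l x) \<and> l \<in> borel_measurable (restrict_space borel {x0..})) \<and>
     (\<forall>c>0. ((\<lambda>x. l (c * x) / l x) \<longlongrightarrow> 1) at_top)"

definition tail_regularly_varying :: "(real \<Rightarrow> real) \<Rightarrow> real \<Rightarrow> bool" where
  "tail_regularly_varying F \<beta> \<longleftrightarrow>
     (\<exists>l. slowly_varying l \<and> (\<forall>w>0. 1 - F w = w powr (- \<beta>) * l w))"

definition weight_cdf :: "'\<omega> measure \<Rightarrow> ('\<omega> \<Rightarrow> real) \<Rightarrow> real \<Rightarrow> real" where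
  "weight_cdf M W = cdf (distr M borel W)"

definition weight_moment :: "'\<omega> measure \<Rightarrow> ('\<omega> \<Rightarrow> real) \<Rightarrow> real \<Rightarrow> real" where
  "weight_moment M W r = prob_space.expectation M (\<lambda>x. W x powr r)"

definition h_fun :: "'\<omega> measure \<Rightarrow> ('\<omega> \<Rightarrow> real) \<Rightarrow> real \<Rightarrow> real \<Rightarrow> real" where
  "h_fun M W a w =
     w * prob_space.expectation M (\<lambda>x. indicator {w..} (W x) * W x powr a) +
     w powr a * prob_space.expectation M (\<lambda>x. indicator {..<w} (W x) * W x)"

text \<open>The equation is meant for \<open>v > 0\<close>. Leaving \<open>v\<close> unrestricted does not affect the
  largest solution once a positive one exists, which is the case for all large \<open>s\<close>.
  Where there is no largest solution, \<open>v_param\<close> is an unspecified real.\<close>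

definition v_param :: "'\<omega> measure \<Rightarrow> ('\<omega> \<Rightarrow> real) \<Rightarrow> real \<Rightarrow> nat \<Rightarrow> real \<Rightarrow> real" where
  "v_param M W a k s = (GREATEST v. fact k =
     s * prob_space.expectation M
           (\<lambda>x. (s * v * h_fun M W a (W x)) ^ k * exp (- (s * v * h_fun M W a (W x)))))"

definition \<sigma>_param :: "'\<omega> measure \<Rightarrow> ('\<omega> \<Rightarrow> real) \<Rightarrow> real \<Rightarrow> nat \<Rightarrow> real \<Rightarrow> real" where
  "\<sigma>_param M W a k s = s * v_param M W a k s"

end

theory Submission
  imports Defs "HOL-Real_Asymp.Real_Asymp"
begin

text \<open>
  Put \<open>G(\<sigma>) = E[(\<sigma> h(W))\<^sup>k exp(-\<sigma> h(W))]\<close>, so that \<open>\<sigma>\<^sub>s\<close> is the largest root of \<open>G(\<sigma>) = k!/s\<close>.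
  Since \<open>h(w) \<sim> \<mu>\<^sub>a w\<close> at \<open>0\<close> and \<open>W\<close> has density \<open>p \<rho> w powr (\<rho> - 1)\<close> near \<open>0\<close>, substituting
  \<open>w = u / \<sigma>\<close> and dominated convergence give
  \<open>G(\<sigma>) \<sigma> powr \<rho> \<longrightarrow> C := p \<rho> \<Gamma>(k + \<rho>) / \<mu>\<^sub>a powr \<rho>\<close>; weights bounded away from \<open>0\<close> contribute an
  exponentially small term because \<open>h\<close> is increasing. As \<open>G\<close> is continuous, eventually positive and
  vanishes at infinity, the largest root exists and tends to infinity, hence
  \<open>\<sigma>\<^sub>s powr \<rho> / s = G(\<sigma>\<^sub>s) \<sigma>\<^sub>s powr \<rho> / k! \<longrightarrow> C / k!\<close>. The upper tail of \<open>W\<close> matters only for the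
  finiteness of \<open>\<mu>\<^sub>a\<close>.
\<close>

section \<open>Asymptotics of the largest root of a rescaled equation\<close>

text \<open>As \<open>0 < r\<close>, the limit makes \<open>G\<close> vanish at infinity through
  positive values, so each low level \<open>c / s\<close> is attained for a last time, and far out.
  That a greatest root exists must itself be proved, since \<open>GREATEST\<close> is unspecified
  otherwise.\<close>

lemma greatest_root_asymptotics:
  fixes G :: "real \<Rightarrow> real"
  assumes cont: "continuous_on {0<..} G"
    and lim: "((\<lambda>x. G x * x powr r) \<longlongrightarrow> C) at_top"
    and "0 < C" "0 < r" "0 < c"
  shows "((\<lambda>s. (s * (GREATEST v. c = s * G (s * v))) powr r / s) \<longlongrightarrow> C / c) at_top"
proof -
  define S where "S s = s * (GREATEST v. c = s * G (s * v))" for s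
  have pos: "\<forall>\<^sub>F x in at_top. 0 < G x"
    using order_tendstoD(1)[OF lim \<open>0 < C\<close>] eventually_gt_at_top[of 0]
    by eventually_elim (simp add: zero_less_mult_iff)
  have "((\<lambda>x. G x * x powr r * x powr (- r)) \<longlongrightarrow> C * 0) at_top"
    using \<open>0 < r\<close> by (intro tendsto_mult lim tendsto_neg_powr filterlim_ident) auto
  then have "((\<lambda>x. G x * x powr r * x powr (- r)) \<longlongrightarrow> 0) at_top" by simp
  then have "(G \<longlongrightarrow> 0) at_top"
    by (rule Lim_transform_eventually)
      (use eventually_gt_at_top[of 0] in eventually_elim, simp add: mult.assoc flip: powr_add)
  note small = order_tendstoD(2)[OF this]
  have S: "\<forall>\<^sub>F s in at_top. B \<le> S s \<and> c = s * G (S s)" for B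
  proof -
    \<comment> \<open>The value at \<open>B'\<close> fixes the threshold for \<open>s\<close>: once
      \<open>c / G B' < s\<close>, the level \<open>c / s\<close> lies below \<open>G B'\<close>,
      and the intermediate value theorem gives a root to the right of \<open>B'\<close>.\<close>
    obtain B' where B': "max B 1 \<le> B'" "0 < G B'"
      using eventually_happens'[OF _ eventually_conj[OF eventually_ge_at_top[of "max B 1"] pos]] by auto
    have root: "B \<le> S s \<and> c = s * G (S s)" if s: "0 < s" "c / G B' < s" for s
    proof -
      have "0 < c / s" "c / s < G B'"
        using s \<open>0 < c\<close> B' by (auto simp: field_simps)
      obtain X0 where X0: "\<And>x. X0 \<le> x \<Longrightarrow> G x < c / s"
        using small[OF \<open>0 < c / s\<close>] by (auto simp: eventually_at_top_linorder)
      define X where "X = max X0 B'"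
      have X: "G x < c / s" if "X \<le> x" for x using X0 that by (auto simp: X_def)
      have cont': "continuous_on {B'..X} G"
        using cont by (rule continuous_on_subset) (use B' in auto)
      \<comment> \<open>No root lies beyond \<open>X\<close>, so all roots from \<open>B'\<close> on
        form the compact set \<open>K\<close>, whose maximum is attained.\<close>
      define K where "K = {x \<in> {B'..X}. G x = c / s}"
      have "\<exists>x\<ge>B'. x \<le> X \<and> G x = c / s"
        by (rule IVT2') (use cont' X[of X] \<open>c / s < G B'\<close> in \<open>auto simp: X_def\<close>)
      then have "K \<noteq> {}" by (auto simp: K_def)
      have "closed K"
        unfolding K_def by (rule continuous_closed_preimage_constant[OF cont']) auto
      moreover have "bounded K"
        by (rule bounded_subset[of "{B'..X}"]) (auto simp: K_def)
      ultimately have "compact K" by (simp add: compact_eq_bounded_closed)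
      then obtain m where m: "m \<in> K" "\<And>x. x \<in> K \<Longrightarrow> x \<le> m"
        using compact_attains_sup[OF _ \<open>K \<noteq> {}\<close>] by blast
      \<comment> \<open>Roots below \<open>B'\<close>, including nonpositive ones, cannot compete
        because \<open>m\<close> is at least \<open>B'\<close>.\<close>
      have max: "y \<le> m" if "G y = c / s" for y
        using m(1) m(2)[of y] X[of y] that by (fastforce simp: K_def)
      have "(GREATEST v. c = s * G (s * v)) = m / s"
      proof (rule Greatest_equality)
        show "c = s * G (s * (m / s))"
          using m(1) s by (auto simp: K_def)
        show "v \<le> m / s" if "c = s * G (s * v)" for v
        proof -
          have "G (s * v) = c / s" using that s by (simp add: field_simps)
          from max[OF this] show ?thesis using s by (simp add: field_simps)
        qed
      qed
      then have "S s = m" using s by (simp add: S_def)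
      then show ?thesis using m(1) s B' by (auto simp: K_def)
    qed
    show ?thesis
      using eventually_gt_at_top[of 0] eventually_gt_at_top[of "c / G B'"]
      by eventually_elim (rule root)
  qed
  have "filterlim S at_top at_top"
    unfolding filterlim_at_top by (auto intro: eventually_mono[OF S])
  from filterlim_compose[OF lim this]
  have "((\<lambda>s. G (S s) * S s powr r / c) \<longlongrightarrow> C / c) at_top"
    by (rule tendsto_divide[OF _ tendsto_const]) (use \<open>0 < c\<close> in simp)
  then show ?thesis
    unfolding S_def[symmetric]
  proof (rule Lim_transform_eventually)
    show "\<forall>\<^sub>F s in at_top. G (S s) * S s powr r / c = S s powr r / s"
      using S[of 0] eventually_gt_at_top[of 0]
    proof eventually_elim
      case (elim s)
      then have "G (S s) = c / s" by (simp add: field_simps)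
      then show ?case using \<open>0 < c\<close> by simp
    qed
  qed
qed

section \<open>A Gamma integral and an exponential bound\<close>

text \<open>Euler's integral after the substitution \<open>t = c * u\<close>. It serves twice: with
  exponent \<rho> for the dominating function, and with \<open>k + \<rho>\<close> for the value of
  the limit.\<close>

lemma has_bochner_integral_exp_powr_Gamma:
  fixes r c :: real
  assumes "0 < r" "0 < c"
  shows "has_bochner_integral lborel
    (\<lambda>u. indicator {0<..} u * u powr (r - 1) * exp (- (c * u))) (Gamma r / c powr r)"
proof -
  have "(\<integral>\<^sup>+t. ennreal (indicator {0<..} t * t powr (r - 1) * exp (- t)) \<partial>lborel) = Gamma r"
    unfolding Gamma_conv_nn_integral_real[OF \<open>0 < r\<close>]
    by (intro nn_integral_cong_AE AE_I[of _ _ "{0}"])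
      (auto split: split_indicator simp: exp_minus field_simps)
  then have "has_bochner_integral lborel
      (\<lambda>t. indicator {0<..} t * t powr (r - 1) * exp (- t)) (Gamma r)"
    using \<open>0 < r\<close> by (intro has_bochner_integral_nn_integral) (auto intro: less_imp_le Gamma_real_pos)
  from lborel_has_bochner_integral_real_affine_iff[THEN iffD1, OF _ this, of c 0]
  have "has_bochner_integral lborel
      (\<lambda>x. indicator {0<..} (c * x) * (c * x) powr (r - 1) * exp (- (c * x))) (Gamma r / c)"
    using \<open>0 < c\<close> by (simp add: mult.assoc divide_inverse mult.commute)
  \<comment> \<open>This factor strips \<open>c\<close> from \<open>(c * x) powr (r - 1)\<close> and
    turns \<open>Gamma r / c\<close> into \<open>Gamma r / c powr r\<close>.\<close>
  from has_bochner_integral_mult_right[OF this, of "c powr (1 - r)"] 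
  show ?thesis
    using \<open>0 < c\<close>
    by (auto elim!: has_bochner_integral_cong[THEN iffD1, rotated -1]
      split: split_indicator simp: zero_less_mult_iff powr_mult powr_diff field_simps)
qed

text \<open>Half of the exponential decay absorbs the power, because
  \<open>(x / 2) ^ k / fact k\<close> is a single term of the series of
  \<open>exp (x / 2)\<close>.\<close>

lemma power_exp_le:
  fixes x :: real
  assumes "0 \<le> x"
  shows "x ^ k * exp (- x) \<le> 2 ^ k * fact k * exp (- (x / 2))"
proof -
  have "(x / 2) ^ k / fact k = (\<Sum>n\<in>{k}. (x / 2) ^ n /\<^sub>R fact n)"
    by (simp add: field_simps)
  also have "\<dots> \<le> (\<Sum>n. (x / 2) ^ n /\<^sub>R fact n)"
    using assms by (intro sum_le_suminf summable_exp_generic) auto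
  also have "\<dots> = exp (x / 2)"
    by (simp only: exp_def)
  finally have "(x / 2) ^ k / fact k \<le> exp (x / 2)" .
  then have "x ^ k \<le> 2 ^ k * fact k * exp (x / 2)"
    by (simp add: power_divide field_simps)
  then have "x ^ k * exp (- x) \<le> 2 ^ k * fact k * exp (x / 2) * exp (- x)"
    by (rule mult_right_mono) auto
  then show ?thesis by (simp add: mult.assoc flip: exp_add)
qed

section \<open>The law of the weight near zero\<close>

text \<open>Both sides are finite Borel measures, so it suffices to compare their distribution
  functions. Positivity of \<open>W\<close> excludes mass on the nonpositive half-line.\<close>

lemma density_of_power_cdf:
  fixes W :: "'\<omega> \<Rightarrow> real"
  assumes "prob_space M" and W[measurable]: "W \<in> borel_measurable M"
    and pos: "\<And>x. x \<in> space M \<Longrightarrow> 0 < W x"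
    and "0 < p" "0 < \<rho>" "0 < b"
    and cdf: "\<And>w. 0 < w \<Longrightarrow> w \<le> b \<Longrightarrow> weight_cdf M W w = p * w powr \<rho>"
  shows "density (distr M borel W) (\<lambda>w. ennreal (indicator {..b} w)) =
    density lborel (\<lambda>w. ennreal (indicator {0<..b} w * (p * \<rho> * w powr (\<rho> - 1))))"
    (is "?L = ?R")
proof -
  interpret prob_space M by fact
  interpret D: real_distribution "distr M borel W" by (rule real_distribution_distr) simp
  have L: "emeasure ?L {..x} = emeasure (distr M borel W) ({..b} \<inter> {..x})" for x
    by (subst emeasure_density)
      (auto simp: ennreal_indicator nn_integral_indicator[symmetric]
        simp del: nn_integral_indicator intro!: nn_integral_cong split: split_indicator)
  have R: "emeasure ?R {..x} = (if x \<le> 0 then 0 else p * (min b x) powr \<rho>)" for x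
  proof (cases "x \<le> 0")
    case True
    then show ?thesis by (auto simp: emeasure_density nn_integral_0_iff_AE split: split_indicator)
  next
    case False
    let ?m = "min b x"
    \<comment> \<open>The exponent exceeds -1 because \<rho> is positive, so a singularity at 0 is
      integrable.\<close>
    have "((\<lambda>w. w powr (\<rho> - 1)) has_integral (?m powr (\<rho> - 1 + 1) / (\<rho> - 1 + 1))) {0..?m}"
      using False assms by (intro has_integral_powr_from_0) auto
    from has_integral_mult_right[OF this, of "p * \<rho>"]
    have "((\<lambda>w. p * \<rho> * w powr (\<rho> - 1)) has_integral (p * ?m powr \<rho>)) {0..?m}"
      using assms by simp
    then have "p * ?m powr \<rho> = (\<integral>\<^sup>+w. indicator {0..?m} w * (p * \<rho> * w powr (\<rho> - 1)) \<partial>lborel)"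
      using assms by (subst nn_integral_has_integral_lebesgue) auto
    also have "\<dots> = emeasure ?R {..x}"
      by (subst emeasure_density, simp, simp, intro nn_integral_cong_AE AE_I[of _ _ "{0}"])
        (auto split: split_indicator simp: indicator_def ennreal_mult' split: if_splits)
    finally show ?thesis using False by simp
  qed
  have fin: "finite_borel_measure ?L"
    by (intro finite_borel_measure.intro finite_borel_measure_axioms.intro finite_measureI)
      (auto simp: emeasure_density ennreal_indicator D.emeasure_eq_measure)
  \<comment> \<open>The density vanishes beyond \<open>b\<close>, so the total mass is read off from
    \<open>R\<close> at \<open>b\<close>.\<close>
  have "emeasure ?R UNIV = emeasure ?R {..b}"
    by (simp add: emeasure_density) (auto intro!: nn_integral_cong split: split_indicator)
  then have fin': "finite_borel_measure ?R"
    by (intro finite_borel_measure.intro finite_borel_measure_axioms.intro finite_measureI)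
      (auto simp: R)
  have "cdf ?L x = cdf ?R x" for x
  proof -
    have D: "emeasure (distr M borel W) {..y} = ennreal (weight_cdf M W y)" for y
      by (simp add: weight_cdf_def cdf_def D.emeasure_eq_measure)
    have "emeasure ?L {..x} = emeasure ?R {..x}"
    proof (cases "x \<le> 0")
      case True
      have "W -` ({..b} \<inter> {..x}) \<inter> space M = {}"
        using True by (fastforce dest: pos)
      then have "emeasure (distr M borel W) ({..b} \<inter> {..x}) = 0"
        by (subst emeasure_distr) auto
      then show ?thesis using True R[of x] L[of x] by simp
    next
      case False
      then have "{..b} \<inter> {..x} = {..min b x}" by auto
      then show ?thesis using False R[of x] L[of x] D[of "min b x"] cdf[of "min b x"] \<open>0 < b\<close> by simp
    qed
    then show ?thesis by (simp add: cdf_def measure_def)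
  qed
  then show ?thesis by (intro cdf_unique' fin fin') auto
qed

lemma expectation_of_power_cdf:
  fixes W :: "'\<omega> \<Rightarrow> real"
  assumes "prob_space M" and W[measurable]: "W \<in> borel_measurable M"
    and "\<And>x. x \<in> space M \<Longrightarrow> 0 < W x"
    and "0 < p" "0 < \<rho>" "0 < b"
    and "\<And>w. 0 < w \<Longrightarrow> w \<le> b \<Longrightarrow> weight_cdf M W w = p * w powr \<rho>"
    and f[measurable]: "f \<in> borel_measurable borel"
  shows "(\<integral>x. indicator {..b} (W x) * f (W x) \<partial>M) =
    (\<integral>w. indicator {0<..b} w * (p * \<rho> * w powr (\<rho> - 1)) * f w \<partial>lborel)"
proof -
  have "(\<integral>x. indicator {..b} (W x) * f (W x) \<partial>M) =
      (\<integral>w. indicator {..b} w * f w \<partial>distr M borel W)"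
    by (subst integral_distr) auto
  also have "\<dots> = (\<integral>w. f w \<partial>density (distr M borel W) (\<lambda>w. ennreal (indicator {..b} w)))"
    by (subst integral_density) auto
  also have "\<dots> = (\<integral>w. f w \<partial>density lborel
      (\<lambda>w. ennreal (indicator {0<..b} w * (p * \<rho> * w powr (\<rho> - 1)))))"
    by (subst density_of_power_cdf) (use assms in auto)
  also have "\<dots> = (\<integral>w. indicator {0<..b} w * (p * \<rho> * w powr (\<rho> - 1)) * f w \<partial>lborel)"
    using assms(4,5) by (subst integral_density) auto
  finally show ?thesis .
qed

section \<open>Finiteness of the moment of order \<open>a\<close>\<close>

text \<open>Along a dyadic sequence \<open>2\<^sup>n w0\<close> the tail decays like \<open>2 powr (- \<gamma> n)\<close> for some \<open>\<gamma> > a\<close>, so the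
  contributions of the dyadic blocks to the moment are dominated by a geometric series.\<close>

lemma integrable_powr_of_tail_regularly_varying:
  fixes W :: "'\<omega> \<Rightarrow> real"
  assumes "prob_space M" and W[measurable]: "W \<in> borel_measurable M"
    and pos: "\<And>x. x \<in> space M \<Longrightarrow> 0 < W x"
    and "0 \<le> a" "a < \<beta>"
    and rv: "tail_regularly_varying (weight_cdf M W) \<beta>"
  shows "integrable M (\<lambda>x. W x powr a)"
proof -
  interpret prob_space M by fact
  define T where "T w = prob {x \<in> space M. w < W x}" for w
  have T: "T w = 1 - weight_cdf M W w" for w
  proof -
    have "weight_cdf M W w = prob {x \<in> space M. \<not> w < W x}"
      unfolding weight_cdf_def cdf_def
      by (subst measure_distr) (auto intro!: arg_cong[where f=prob])
    also have "\<dots> = 1 - T w"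
      unfolding T_def by (rule prob_neg) simp
    finally show ?thesis by simp
  qed
  obtain l where l: "slowly_varying l" "\<And>w. 0 < w \<Longrightarrow> T w = w powr (- \<beta>) * l w"
    using rv by (auto simp: tail_regularly_varying_def T)
  \<comment> \<open>Any exponent strictly between works: \<gamma> < \<beta> leaves room for the
    slowly varying factor, and \<open>a\<close> < \<gamma> makes the geometric series
    converge.\<close>
  define \<gamma> where "\<gamma> = (a + \<beta>) / 2"
  have \<gamma>: "a < \<gamma>" "\<gamma> < \<beta>" using \<open>a < \<beta>\<close> by (auto simp: \<gamma>_def)
  have l_pos: "\<forall>\<^sub>F w in at_top. 0 < l w"
    using l(1) by (auto simp: slowly_varying_def eventually_at_top_linorder)
  have "((\<lambda>w. l (2 * w) / l w) \<longlongrightarrow> 1) at_top"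
    using l(1) by (simp add: slowly_varying_def)
  moreover have "1 < (2::real) powr (\<beta> - \<gamma>)"
    using \<gamma> by simp
  ultimately have "\<forall>\<^sub>F w in at_top. l (2 * w) / l w < 2 powr (\<beta> - \<gamma>)"
    by (rule order_tendstoD)
  with l_pos eventually_gt_at_top[of 0]
  have "\<forall>\<^sub>F w in at_top. 0 < w \<and> T (2 * w) \<le> 2 powr (- \<gamma>) * T w"
  proof eventually_elim
    case (elim w)
    then have "l (2 * w) \<le> 2 powr (\<beta> - \<gamma>) * l w"
      by (simp add: field_simps)
    then have "(2 * w) powr (- \<beta>) * l (2 * w) \<le> (2 * w) powr (- \<beta>) * (2 powr (\<beta> - \<gamma>) * l w)"
      by (rule mult_left_mono) simp
    also have "\<dots> = 2 powr (- \<gamma>) * (w powr (- \<beta>) * l w)"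
      using elim by (simp add: powr_mult powr_diff powr_minus field_simps)
    finally show ?case using elim by (simp add: l(2))
  qed
  then obtain w0 where w0: "\<And>w. w0 \<le> w \<Longrightarrow> 0 < w \<and> T (2 * w) \<le> 2 powr (- \<gamma>) * T w"
    by (auto simp: eventually_at_top_linorder)
  then have "0 < w0" by auto
  have decay: "T (2 ^ n * w0) \<le> (2 powr (- \<gamma>)) ^ n" for n
  proof (induction n)
    case 0
    show ?case by (simp add: T_def)
  next
    case (Suc n)
    have "w0 \<le> 2 ^ n * w0" using \<open>0 < w0\<close> by simp
    then have "T (2 * (2 ^ n * w0)) \<le> 2 powr (- \<gamma>) * T (2 ^ n * w0)" using w0 by blast
    also have "\<dots> \<le> 2 powr (- \<gamma>) * (2 powr (- \<gamma>)) ^ n"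
      by (intro mult_left_mono Suc) auto
    finally show ?case by (simp add: mult.assoc)
  qed
  \<comment> \<open>The constant bounds \<open>W x powr a\<close> on the block from
    \<open>2 ^ n * w0\<close> to \<open>2 ^ Suc n * w0\<close>. The indicator covers everything
    above the lower end, which only enlarges the bound and makes the integral a multiple of
    \<open>T (2 ^ n * w0)\<close>.\<close>
  define f where "f n x = (2 ^ Suc n * w0) powr a * indicator {2 ^ n * w0<..} (W x)" for n x
  have f[measurable]: "f n \<in> borel_measurable M" for n by (simp add: f_def[abs_def])
  have bound: "ennreal (W x powr a) \<le> ennreal (w0 powr a) + (\<Sum>n. ennreal (f n x))"
    if x: "x \<in> space M" for x
  proof (cases "W x \<le> w0")
    case True
    then have "W x powr a \<le> w0 powr a"
      using pos[OF x] \<open>0 \<le> a\<close> by (intro powr_mono2) auto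
    then show ?thesis by (intro add_increasing2) (auto intro: ennreal_leI)
  next
    case False
    obtain m where "W x / w0 < 2 ^ m"
      using real_arch_pow[of 2 "W x / w0"] by auto
    then have ex: "W x \<le> 2 ^ m * w0" using \<open>0 < w0\<close> by (simp add: field_simps)
    \<comment> \<open>\<open>W x\<close> exceeds \<open>w0\<close>, so \<open>N\<close> is positive,
      and its predecessor indexes the block containing \<open>W x\<close>.\<close>
    define N where "N = (LEAST n. W x \<le> 2 ^ n * w0)"
    have N: "W x \<le> 2 ^ N * w0"
      unfolding N_def using ex by (rule LeastI)
    then obtain n where n: "N = Suc n" using False by (cases N) auto
    then have "\<not> W x \<le> 2 ^ n * w0"
      unfolding N_def by (intro not_less_Least) simp
    then have "W x powr a \<le> f n x"
      using N n pos[OF x] \<open>0 \<le> a\<close> by (auto simp: f_def intro!: powr_mono2)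
    then have "ennreal (W x powr a) \<le> (\<Sum>i\<in>{n}. ennreal (f i x))"
      by (simp add: ennreal_leI)
    also have "\<dots> \<le> (\<Sum>i. ennreal (f i x))"
      by (intro sum_le_suminf) auto
    finally show ?thesis by (simp add: add_increasing)
  qed
  have int_f: "(\<integral>\<^sup>+x. f n x \<partial>M) \<le> ennreal ((2 * w0) powr a * (2 powr (a - \<gamma>)) ^ n)" for n
  proof -
    have "(\<integral>\<^sup>+x. f n x \<partial>M) = ennreal ((2 ^ Suc n * w0) powr a) * emeasure M {x \<in> space M. 2 ^ n * w0 < W x}"
      by (subst nn_integral_cmult_indicator[symmetric])
        (auto simp: f_def ennreal_mult' intro!: nn_integral_cong split: split_indicator)
    also have "\<dots> = ennreal ((2 ^ Suc n * w0) powr a * T (2 ^ n * w0))"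
      by (simp add: emeasure_eq_measure T_def ennreal_mult')
    also have "\<dots> \<le> ennreal ((2 ^ Suc n * w0) powr a * (2 powr (- \<gamma>)) ^ n)"
      by (intro ennreal_leI mult_left_mono decay) auto
    also have "(2 ^ Suc n * w0) powr a * (2 powr (- \<gamma>)) ^ n = (2 * w0) powr a * (2 powr (a - \<gamma>)) ^ n"
    proof -
      have "(2 ^ Suc n * w0) powr a = (2 * w0) powr a * (2 ^ n) powr a"
        using \<open>0 < w0\<close> by (simp add: powr_mult)
      moreover have "((2::real) ^ n) powr a = (2 powr a) ^ n"
        by (simp add: powr_powr mult.commute flip: powr_realpow)
      moreover have "(2::real) powr (a - \<gamma>) = 2 powr a * 2 powr (- \<gamma>)"
        by (simp flip: powr_add)
      ultimately show ?thesis by (simp add: power_mult_distrib)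
    qed
    finally show ?thesis .
  qed
  have "(2::real) powr (a - \<gamma>) < 1"
    using \<gamma> powr_less_mono[of "a - \<gamma>" 0 2] by simp
  then have summable: "summable (\<lambda>n. (2 * w0) powr a * (2 powr (a - \<gamma>)) ^ n)"
    by (intro summable_mult summable_geometric) simp
  have "(\<integral>\<^sup>+x. ennreal (W x powr a) \<partial>M) \<le> (\<integral>\<^sup>+x. ennreal (w0 powr a) + (\<Sum>n. ennreal (f n x)) \<partial>M)"
    by (intro nn_integral_mono bound)
  also have "\<dots> = ennreal (w0 powr a) + (\<Sum>n. \<integral>\<^sup>+x. f n x \<partial>M)"
    by (simp add: nn_integral_add nn_integral_suminf emeasure_space_1)
  also have "\<dots> \<le> ennreal (w0 powr a) + (\<Sum>n. ennreal ((2 * w0) powr a * (2 powr (a - \<gamma>)) ^ n))"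
    by (intro add_left_mono suminf_le int_f) auto
  also have "\<dots> < \<infinity>"
    using summable by (subst suminf_ennreal2) auto
  finally show ?thesis
    by (intro integrableI_nonneg) auto
qed

section \<open>Measurability, monotonicity and slope at zero of \<open>h\<close>\<close>

lemma borel_measurable_h_fun:
  assumes "prob_space M" and [measurable]: "W \<in> borel_measurable M"
  shows "h_fun M W a \<in> borel_measurable borel"
proof -
  interpret prob_space M by fact
  \<comment> \<open>With conditionals in place of indicators of sets depending on \<open>w\<close>,
    the integrands are recognised as jointly measurable in \<open>w\<close> and
    \<open>x\<close>.\<close>
  have "h_fun M W a = (\<lambda>w. w * (\<integral>x. (if w \<le> W x then 1 else 0) * W x powr a \<partial>M) +
      w powr a * (\<integral>x. (if W x < w then 1 else 0) * W x \<partial>M))"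
    by (simp add: h_fun_def fun_eq_iff indicator_def of_bool_def)
  also have "\<dots> \<in> borel_measurable borel"
    by measurable
  finally show ?thesis .
qed

text \<open>In this form the kernel of \<open>h\<close> is visibly monotone in \<open>w\<close>.\<close>

lemma h_fun_eq_min_max:
  assumes "prob_space M" and [measurable]: "W \<in> borel_measurable M"
    and pos: "\<And>x. x \<in> space M \<Longrightarrow> 0 < W x"
    and int: "integrable M (\<lambda>x. W x powr a)" and "0 < w"
  shows "integrable M (\<lambda>x. min w (W x) * max w (W x) powr a)"
    and "h_fun M W a w = (\<integral>x. min w (W x) * max w (W x) powr a \<partial>M)"
proof -
  interpret prob_space M by fact
  have 1: "integrable M (\<lambda>x. w * (indicator {w..} (W x) * W x powr a))"
    by (rule integrable_mult_right, rule Bochner_Integration.integrable_bound[OF int])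
      (auto split: split_indicator)
  \<comment> \<open>The indicator keeps the integrated weight below \<open>w\<close>, so this holds
    even when \<open>W\<close> has infinite mean.\<close>
  have 2: "integrable M (\<lambda>x. w powr a * (indicator {..<w} (W x) * W x))"
    by (rule integrable_mult_right, rule integrable_const_bound[of _ w])
      (use \<open>0 < w\<close> in \<open>auto split: split_indicator intro!: AE_I2 dest: pos\<close>)
  have eq: "min w (W x) * max w (W x) powr a =
      w * (indicator {w..} (W x) * W x powr a) + w powr a * (indicator {..<w} (W x) * W x)" for x
    by (auto split: split_indicator simp: min_def max_def)
  show "integrable M (\<lambda>x. min w (W x) * max w (W x) powr a)"
    unfolding eq by (intro Bochner_Integration.integrable_add 1 2)
  show "h_fun M W a w = (\<integral>x. min w (W x) * max w (W x) powr a \<partial>M)"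
    unfolding eq h_fun_def by (subst Bochner_Integration.integral_add[OF 1 2]) simp
qed

lemma h_fun_mono:
  assumes "prob_space M" "W \<in> borel_measurable M"
    and pos: "\<And>x. x \<in> space M \<Longrightarrow> 0 < W x"
    and "0 \<le> a" and "integrable M (\<lambda>x. W x powr a)" and "0 < w" "w \<le> w'"
  shows "h_fun M W a w \<le> h_fun M W a w'"
proof -
  note eq = h_fun_eq_min_max[OF assms(1-3,5)]
  have "(\<integral>x. min w (W x) * max w (W x) powr a \<partial>M) \<le> (\<integral>x. min w' (W x) * max w' (W x) powr a \<partial>M)"
  proof (rule integral_mono[OF eq(1) eq(1)])
    fix x assume "x \<in> space M"
    from pos[OF this] show "min w (W x) * max w (W x) powr a \<le> min w' (W x) * max w' (W x) powr a"
      using assms(4,6,7) by (intro mult_mono powr_mono2) auto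
  qed (use assms in auto)
  then show ?thesis
    using assms(6,7) by (simp add: eq(2))
qed

lemma weight_moment_pos:
  assumes "prob_space M"
    and pos: "\<And>x. x \<in> space M \<Longrightarrow> 0 < W x"
    and int: "integrable M (\<lambda>x. W x powr a)"
  shows "0 < weight_moment M W a"
proof -
  interpret prob_space M by fact
  have "weight_moment M W a \<noteq> 0"
  proof
    assume "weight_moment M W a = 0"
    then have "AE x in M. W x powr a = 0"
      using integral_nonneg_eq_0_iff_AE[OF int] by (simp add: weight_moment_def)
    with AE_space have "AE x in M. False"
      by eventually_elim (auto dest: pos)
    then show False by simp
  qed
  moreover have "0 \<le> weight_moment M W a"
    by (simp add: weight_moment_def)
  ultimately show ?thesis by simp
qed

text \<open>Divided by \<open>w\<close>, the kernel is
  \<open>min 1 (W / w) * max w W powr a\<close>. It converges pointwise to \<open>W powr a\<close>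
  and is at most \<open>W powr a + 1\<close> for \<open>w \<le> 1\<close>. Setting
  \<open>w = inverse t\<close> moves the limit to infinity, where dominated convergence is available
  for a real parameter.\<close>

lemma h_fun_over_id_tendsto:
  assumes "prob_space M" and [measurable]: "W \<in> borel_measurable M"
    and pos: "\<And>x. x \<in> space M \<Longrightarrow> 0 < W x"
    and "0 \<le> a" and int: "integrable M (\<lambda>x. W x powr a)"
  shows "((\<lambda>w. h_fun M W a w / w) \<longlongrightarrow> weight_moment M W a) (at_right 0)"
proof -
  interpret prob_space M by fact
  let ?\<kappa> = "\<lambda>t x. t * (min (inverse t) (W x) * max (inverse t) (W x) powr a)"
  have "((\<lambda>t. \<integral>x. ?\<kappa> t x \<partial>M) \<longlongrightarrow> (\<integral>x. W x powr a \<partial>M)) at_top"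
  proof (rule integral_dominated_convergence_at_top)
    show "integrable M (\<lambda>x. W x powr a + 1)" using int by simp
    show "AE x in M. ((\<lambda>t. ?\<kappa> t x) \<longlongrightarrow> W x powr a) at_top"
    proof (rule AE_I2)
      fix x assume x: "x \<in> space M"
      \<comment> \<open>Once \<open>inverse t\<close> is below \<open>W x\<close>, the minimum
        cancels the factor \<open>t\<close>, and the limit is attained exactly.\<close>
      have "\<forall>\<^sub>F t in at_top. W x powr a = ?\<kappa> t x"
        using eventually_gt_at_top[of "inverse (W x)"] eventually_gt_at_top[of 0]
      proof eventually_elim
        case (elim t)
        then have "inverse t < W x" using pos[OF x]
          by (simp add: field_simps)
        then show ?case using elim by (simp add: min_def max_def)
      qed
      then show "((\<lambda>t. ?\<kappa> t x) \<longlongrightarrow> W x powr a) at_top"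
        by (rule tendsto_eventually[OF eventually_mono]) simp
    qed
    show "\<forall>\<^sub>F t in at_top. AE x in M. norm (?\<kappa> t x) \<le> W x powr a + 1"
      using eventually_ge_at_top[of 1]
    proof (eventually_elim, intro AE_I2)
      fix t :: real and x assume t: "1 \<le> t" and x: "x \<in> space M"
      let ?w = "inverse t"
      have w: "0 < ?w" "?w \<le> 1" using t by (auto simp: field_simps)
      have "max ?w (W x) powr a \<le> W x powr a + 1"
        using powr_mono2[of a ?w 1] w \<open>0 \<le> a\<close> pos[OF x]
        by (auto simp: max_def add_increasing)
      moreover have "t * min ?w (W x) \<le> t * ?w"
        using t by (intro mult_left_mono) auto
      ultimately have "(t * min ?w (W x)) * max ?w (W x) powr a \<le> (t * ?w) * (W x powr a + 1)"
        using t w pos[OF x] by (intro mult_mono) auto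
      then show "norm (?\<kappa> t x) \<le> W x powr a + 1"
        using t pos[OF x] by (simp add: mult.assoc abs_mult)
    qed
  qed measurable
  then have "((\<lambda>t. h_fun M W a (inverse t) / inverse t) \<longlongrightarrow> weight_moment M W a) at_top"
    unfolding weight_moment_def
  proof (rule Lim_transform_eventually)
    show "\<forall>\<^sub>F t in at_top. (\<integral>x. ?\<kappa> t x \<partial>M) = h_fun M W a (inverse t) / inverse t"
      using eventually_gt_at_top[of 0]
      by eventually_elim
        (simp add: h_fun_eq_min_max(2)[OF assms(1,2) pos int] divide_inverse mult.commute)
  qed
  then show ?thesis by (simp only: filterlim_at_right_to_top)
qed

section \<open>Continuity and asymptotics of the expectation\<close>

text \<open>Bounded convergence along sequences: for nonnegative arguments
  \<open>power_exp_le\<close> bounds the integrand by a constant independent of \<sigma>.\<close>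

lemma continuous_on_expectation_power_exp:
  fixes X :: "'\<omega> \<Rightarrow> real"
  assumes "prob_space M" and [measurable]: "X \<in> borel_measurable M"
    and nonneg: "\<And>x. x \<in> space M \<Longrightarrow> 0 \<le> X x"
  shows "continuous_on {0<..} (\<lambda>\<sigma>. \<integral>x. (\<sigma> * X x) ^ k * exp (- (\<sigma> * X x)) \<partial>M)"
proof -
  interpret prob_space M by fact
  show ?thesis
    unfolding continuous_on_sequentially comp_def
  proof (intro allI ballI impI)
    fix s :: "nat \<Rightarrow> real" and \<sigma>
    assume s: "(\<forall>n. s n \<in> {0<..}) \<and> s \<longlonglongrightarrow> \<sigma>"
    show "(\<lambda>n. \<integral>x. (s n * X x) ^ k * exp (- (s n * X x)) \<partial>M)
      \<longlonglongrightarrow> (\<integral>x. (\<sigma> * X x) ^ k * exp (- (\<sigma> * X x)) \<partial>M)"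
    proof (rule integral_dominated_convergence)
      show "integrable M (\<lambda>x. 2 ^ k * fact k :: real)" by simp
      show "AE x in M. (\<lambda>n. (s n * X x) ^ k * exp (- (s n * X x)))
          \<longlonglongrightarrow> (\<sigma> * X x) ^ k * exp (- (\<sigma> * X x))"
        using s by (intro AE_I2 tendsto_intros) auto
      show "AE x in M. norm ((s n * X x) ^ k * exp (- (s n * X x))) \<le> 2 ^ k * fact k" for n
      proof (rule AE_I2)
        fix x assume "x \<in> space M"
        then have nn: "0 \<le> s n * X x" using s nonneg[of x] by (auto intro!: mult_nonneg_nonneg simp: less_imp_le)
        have "2 ^ k * fact k * exp (- (s n * X x / 2)) \<le> 2 ^ k * fact k * (1::real)"
          using nn by (intro mult_left_mono) auto
        moreover have "0 \<le> (s n * X x) ^ k * exp (- (s n * X x))"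
          using nn by simp
        ultimately show "norm ((s n * X x) ^ k * exp (- (s n * X x))) \<le> 2 ^ k * fact k"
          using power_exp_le[OF nn, of k] unfolding real_norm_def by linarith
      qed
    qed measurable
  qed
qed

text \<open>The expectation is split at a small threshold \<open>d\<close>. Below it the explicit
  density and the slope \<mu> produce the Gamma integral; above it monotonicity gives
  \<open>h d \<le> h w\<close>, hence exponential decay. Stated for abstract \<open>h\<close>, to
  show which of its properties enter.\<close>

lemma expectation_power_exp_asymptotics:
  fixes W :: "'\<omega> \<Rightarrow> real" and h :: "real \<Rightarrow> real"
  assumes "prob_space M" and [measurable]: "W \<in> borel_measurable M"
    and pos: "\<And>x. x \<in> space M \<Longrightarrow> 0 < W x"
    and "0 < p" "0 < \<rho>" "0 < b"
    and cdf: "\<And>w. 0 < w \<Longrightarrow> w \<le> b \<Longrightarrow> weight_cdf M W w = p * w powr \<rho>"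
    and h[measurable]: "h \<in> borel_measurable borel"
    and mono: "\<And>w w'. 0 < w \<Longrightarrow> w \<le> w' \<Longrightarrow> h w \<le> h w'"
    and lim: "((\<lambda>w. h w / w) \<longlongrightarrow> \<mu>) (at_right 0)" and "0 < \<mu>"
  shows "((\<lambda>\<sigma>. (\<integral>x. (\<sigma> * h (W x)) ^ k * exp (- (\<sigma> * h (W x))) \<partial>M) * \<sigma> powr \<rho>) \<longlongrightarrow>
    p * \<rho> * Gamma (real k + \<rho>) / \<mu> powr \<rho>) at_top"
proof -
  interpret prob_space M by fact
  define g where "g x = x ^ k * exp (- x)" for x :: real
  define K :: real where "K = 2 ^ k * fact k"
  have [measurable]: "g \<in> borel_measurable borel" by (simp add: g_def[abs_def])
  have "0 < K" by (simp add: K_def)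
  have g_nonneg: "0 \<le> g x" if "0 \<le> x" for x
    using that by (simp add: g_def)
  \<comment> \<open>\<open>g\<close> need not be monotone, but its majorant decreases, so a lower
    bound on the argument gives an upper bound on \<open>g\<close>.\<close>
  have g_le: "g x \<le> K * exp (- (y / 2))" if "0 \<le> y" "y \<le> x" for x y
  proof -
    have "K * exp (- (x / 2)) \<le> K * exp (- (y / 2))"
      using that \<open>0 < K\<close> by (intro mult_left_mono) auto
    moreover have "g x \<le> K * exp (- (x / 2))"
      unfolding g_def K_def by (rule power_exp_le) (use that in simp)
    ultimately show ?thesis by linarith
  qed
  have g_le_K: "norm (g x) \<le> K" if "0 \<le> x" for x
    using g_le[of 0 x] g_nonneg[OF that] that by simp

  have "\<forall>\<^sub>F w in at_right 0. \<mu> / 2 < h w / w"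
    using order_tendstoD(1)[OF lim, of "\<mu> / 2"] \<open>0 < \<mu>\<close> by simp
  then obtain e where e: "0 < e" "\<And>w. 0 < w \<Longrightarrow> w < e \<Longrightarrow> \<mu> / 2 < h w / w"
    unfolding eventually_at_right_field by auto
  \<comment> \<open>Halving \<open>e\<close> puts \<open>d\<close> itself inside the open interval
    where the slope bound holds; the minimum with \<open>b\<close> keeps the density explicit up to
    \<open>d\<close>.\<close>
  define d where "d = min b (e / 2)"
  have d: "0 < d" "d \<le> b" using e \<open>0 < b\<close> by (auto simp: d_def)
  have h_lower: "\<mu> / 2 * w \<le> h w" if "0 < w" "w \<le> d" for w
    using e(2)[of w] that e(1) by (auto simp: d_def field_simps min_def split: if_splits)
  have "0 < \<mu> / 2 * d" using d \<open>0 < \<mu>\<close> by simp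
  with h_lower[of d] d have "0 < h d" by linarith
  have h_pos: "0 < h w" if "0 < w" for w
  proof (cases "w \<le> d")
    case True
    have "0 < \<mu> / 2 * w" using that \<open>0 < \<mu>\<close> by simp
    with h_lower[OF that True] show ?thesis by linarith
  next
    case False
    with mono[of d w] d \<open>0 < h d\<close> show ?thesis by simp
  qed

  define A where "A \<sigma> = (\<integral>x. indicator {..d} (W x) * g (\<sigma> * h (W x)) \<partial>M)" for \<sigma>
  define B where "B \<sigma> = (\<integral>x. indicator {d<..} (W x) * g (\<sigma> * h (W x)) \<partial>M)" for \<sigma>
  have split: "(\<integral>x. g (\<sigma> * h (W x)) \<partial>M) = A \<sigma> + B \<sigma>" if "0 < \<sigma>" for \<sigma>
  proof -
    have nn: "0 \<le> \<sigma> * h (W x)" if "x \<in> space M" for x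
      using h_pos[OF pos[OF that]] \<open>0 < \<sigma>\<close> by simp
    have int: "integrable M (\<lambda>x. indicator S (W x) * g (\<sigma> * h (W x)))" if [measurable]: "S \<in> sets borel" for S
      using \<open>0 < K\<close>
      by (intro integrable_const_bound[of _ K]) (auto split: split_indicator intro!: AE_I2 g_le_K[unfolded real_norm_def] nn)
    have "A \<sigma> + B \<sigma> = (\<integral>x. indicator {..d} (W x) * g (\<sigma> * h (W x)) +
        indicator {d<..} (W x) * g (\<sigma> * h (W x)) \<partial>M)"
      unfolding A_def B_def by (rule Bochner_Integration.integral_add[symmetric]) (simp_all add: int)
    also have "\<dots> = (\<integral>x. g (\<sigma> * h (W x)) \<partial>M)"
      by (intro Bochner_Integration.integral_cong) (auto split: split_indicator)
    finally show ?thesis by simp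
  qed

  have B_lim: "((\<lambda>\<sigma>. B \<sigma> * \<sigma> powr \<rho>) \<longlongrightarrow> 0) at_top"
  proof (rule tendsto_sandwich[OF _ _ tendsto_const])
    have B: "0 \<le> B \<sigma> \<and> B \<sigma> \<le> K * exp (- (\<sigma> * h d / 2))" if "0 < \<sigma>" for \<sigma>
    proof
      have *: "0 \<le> indicator {d<..} (W x) * g (\<sigma> * h (W x))"
        "indicator {d<..} (W x) * g (\<sigma> * h (W x)) \<le> K * exp (- (\<sigma> * h d / 2))"
        if "x \<in> space M" for x
        using h_pos[OF pos[OF that]] \<open>0 < \<sigma>\<close> \<open>0 < h d\<close> mono[OF d(1), of "W x"] \<open>0 < K\<close>
        by (auto split: split_indicator intro!: g_nonneg g_le)
      show "0 \<le> B \<sigma>" unfolding B_def by (intro integral_nonneg_AE AE_I2 *)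
      show "B \<sigma> \<le> K * exp (- (\<sigma> * h d / 2))"
        unfolding B_def
        by (intro integral_le_const integrable_const_bound[of _ "K * exp (- (\<sigma> * h d / 2))"] AE_I2)
          (use * in auto)
    qed
    show "\<forall>\<^sub>F \<sigma> in at_top. 0 \<le> B \<sigma> * \<sigma> powr \<rho>"
      using eventually_gt_at_top[of 0] by eventually_elim (use B in auto)
    show "\<forall>\<^sub>F \<sigma> in at_top. B \<sigma> * \<sigma> powr \<rho> \<le> K * exp (- (\<sigma> * h d / 2)) * \<sigma> powr \<rho>"
      using eventually_gt_at_top[of 0] by eventually_elim (use B in \<open>auto intro!: mult_right_mono\<close>)
    show "((\<lambda>\<sigma>. K * exp (- (\<sigma> * h d / 2)) * \<sigma> powr \<rho>) \<longlongrightarrow> 0) at_top"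
      using \<open>0 < h d\<close> \<open>0 < K\<close> \<open>0 < \<rho>\<close> by real_asymp
  qed

  \<comment> \<open>The integrand of \<open>A\<close> after \<open>w = u / \<sigma>\<close>: the
    Jacobian \<open>1 / \<sigma>\<close> and the factor \<open>\<sigma> powr \<rho>\<close> together
    turn \<open>(u / \<sigma>) powr (\<rho> - 1)\<close> into \<open>u powr (\<rho> - 1)\<close>.
    Its pointwise limit is \<open>?f\<close>.\<close>
  let ?F = "\<lambda>\<sigma> u. indicator {0<..d} (u / \<sigma>) * (p * \<rho> * u powr (\<rho> - 1)) * g (\<sigma> * h (u / \<sigma>))"
  let ?f = "\<lambda>u. indicator {0<..} u * (p * \<rho> * u powr (\<rho> - 1)) * g (u * \<mu>)"
  have A_eq: "A \<sigma> * \<sigma> powr \<rho> = (\<integral>u. ?F \<sigma> u \<partial>lborel)" if "0 < \<sigma>" for \<sigma>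
  proof -
    let ?H = "\<lambda>u. indicator {0<..d} (u / \<sigma>) * (p * \<rho> * (u / \<sigma>) powr (\<rho> - 1)) * g (\<sigma> * h (u / \<sigma>))"
    have "A \<sigma> = (\<integral>w. indicator {0<..d} w * (p * \<rho> * w powr (\<rho> - 1)) * g (\<sigma> * h w) \<partial>lborel)"
      unfolding A_def
      by (rule expectation_of_power_cdf[where f="\<lambda>w. g (\<sigma> * h w)"]) (use assms d in auto)
    also have "\<dots> = (\<integral>u. ?H u \<partial>lborel) / \<sigma>"
      using that by (subst lborel_integral_real_affine[where c="1 / \<sigma>" and t=0]) auto
    finally have "A \<sigma> * \<sigma> powr \<rho> = (\<integral>u. ?H u \<partial>lborel) * \<sigma> powr (\<rho> - 1)"
      using that by (simp add: powr_diff)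
    also have "\<dots> = (\<integral>u. ?H u * \<sigma> powr (\<rho> - 1) \<partial>lborel)"
      by (rule integral_mult_left_zero[symmetric])
    also have "\<dots> = (\<integral>u. ?F \<sigma> u \<partial>lborel)"
    proof (intro Bochner_Integration.integral_cong refl)
      fix u :: real
      show "?H u * \<sigma> powr (\<rho> - 1) = ?F \<sigma> u"
      proof (cases "0 < u")
        case True
        then have "u powr (\<rho> - 1) = (u / \<sigma>) powr (\<rho> - 1) * \<sigma> powr (\<rho> - 1)"
          using that by (simp flip: powr_mult)
        then show ?thesis by simp
      next
        case False
        then show ?thesis using that by (simp add: zero_less_divide_iff)
      qed
    qed
    finally show ?thesis .
  qed
  have "((\<lambda>\<sigma>. \<integral>u. ?F \<sigma> u \<partial>lborel) \<longlongrightarrow> (\<integral>u. ?f u \<partial>lborel)) at_top"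
  proof (rule integral_dominated_convergence_at_top)
    \<comment> \<open>The rate is \<mu> / 4: one factor 1/2 is lost in \<open>h_lower\<close>, the
      other in \<open>power_exp_le\<close>.\<close>
    have "integrable lborel (\<lambda>u. indicator {0<..} u * u powr (\<rho> - 1) * exp (- (\<mu> / 4 * u)))"
      using has_bochner_integral_exp_powr_Gamma[of \<rho> "\<mu> / 4"] \<open>0 < \<rho>\<close> \<open>0 < \<mu>\<close> by (simp add: has_bochner_integral_iff)
    from integrable_mult_right[OF this, of "K * p * \<rho>"]
    show "integrable lborel (\<lambda>u. indicator {0<..} u * (p * \<rho> * u powr (\<rho> - 1)) * (K * exp (- (\<mu> * u / 2 / 2))))"
      by (simp add: ac_simps)
    show "AE u in lborel. ((\<lambda>\<sigma>. ?F \<sigma> u) \<longlongrightarrow> ?f u) at_top"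
    proof (rule AE_I2)
      fix u :: real
      show "((\<lambda>\<sigma>. ?F \<sigma> u) \<longlongrightarrow> ?f u) at_top"
      proof (cases "0 < u")
        case False
        have "\<forall>\<^sub>F \<sigma> in at_top. ?F \<sigma> u = ?f u"
          using eventually_gt_at_top[of 0]
          by eventually_elim (use False in \<open>auto split: split_indicator simp: zero_less_divide_iff\<close>)
        then show ?thesis by (rule tendsto_eventually)
      next
        case True
        have "filterlim (\<lambda>\<sigma>. u / \<sigma>) (at_right 0) at_top"
          using True by real_asymp
        then have "((\<lambda>\<sigma>. h (u / \<sigma>) / (u / \<sigma>)) \<longlongrightarrow> \<mu>) at_top"
          by (rule filterlim_compose[OF lim])
        then have "((\<lambda>\<sigma>. p * \<rho> * u powr (\<rho> - 1) * g (u * (h (u / \<sigma>) / (u / \<sigma>)))) \<longlongrightarrow>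
            p * \<rho> * u powr (\<rho> - 1) * g (u * \<mu>)) at_top"
          unfolding g_def by (intro tendsto_intros)
        \<comment> \<open>For \<sigma> beyond \<open>u / d\<close> the indicator is 1, and the
          argument of \<open>g\<close> is \<open>u\<close> times the slope quotient of
          \<open>h\<close> at \<open>u / \<sigma>\<close>.\<close>
        moreover have "\<forall>\<^sub>F \<sigma> in at_top. p * \<rho> * u powr (\<rho> - 1) * g (u * (h (u / \<sigma>) / (u / \<sigma>))) = ?F \<sigma> u"
          using eventually_gt_at_top[of 0] eventually_gt_at_top[of "u / d"]
        proof eventually_elim
          case (elim \<sigma>)
          then have "u / \<sigma> \<in> {0<..d}" using True d by (simp add: field_simps)
          moreover have "u * (h (u / \<sigma>) / (u / \<sigma>)) = \<sigma> * h (u / \<sigma>)" using True elim by simp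
          ultimately show ?case by simp
        qed
        ultimately show ?thesis using True by (auto intro: Lim_transform_eventually)
      qed
    qed
    show "\<forall>\<^sub>F \<sigma> in at_top. AE u in lborel. norm (?F \<sigma> u) \<le>
        indicator {0<..} u * (p * \<rho> * u powr (\<rho> - 1)) * (K * exp (- (\<mu> * u / 2 / 2)))"
      using eventually_gt_at_top[of 0]
    proof (eventually_elim, intro AE_I2)
      fix \<sigma> u :: real assume "0 < \<sigma>"
      show "norm (?F \<sigma> u) \<le> indicator {0<..} u * (p * \<rho> * u powr (\<rho> - 1)) * (K * exp (- (\<mu> * u / 2 / 2)))"
      proof (cases "u / \<sigma> \<in> {0<..d}")
        case True
        then have "0 < u" using \<open>0 < \<sigma>\<close> by (simp add: zero_less_divide_iff)
        have "\<sigma> * (\<mu> / 2 * (u / \<sigma>)) \<le> \<sigma> * h (u / \<sigma>)"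
          using h_lower[of "u / \<sigma>"] True \<open>0 < \<sigma>\<close> by (intro mult_left_mono) auto
        then have le: "\<mu> * u / 2 \<le> \<sigma> * h (u / \<sigma>)" using \<open>0 < \<sigma>\<close> by simp
        have nn: "0 \<le> \<mu> * u / 2" using \<open>0 < u\<close> \<open>0 < \<mu>\<close> by simp
        have "(p * \<rho> * u powr (\<rho> - 1)) * g (\<sigma> * h (u / \<sigma>)) \<le>
            (p * \<rho> * u powr (\<rho> - 1)) * (K * exp (- (\<mu> * u / 2 / 2)))"
          using g_le[OF nn le] \<open>0 < p\<close> \<open>0 < \<rho>\<close> by (intro mult_left_mono) auto
        moreover have "0 \<le> (p * \<rho> * u powr (\<rho> - 1)) * g (\<sigma> * h (u / \<sigma>))"
          using g_nonneg[of "\<sigma> * h (u / \<sigma>)"] le nn \<open>0 < p\<close> \<open>0 < \<rho>\<close>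
          by (intro mult_nonneg_nonneg) auto
        ultimately show ?thesis
          using True \<open>0 < u\<close> by simp
      next
        case False
        then show ?thesis using \<open>0 < K\<close> \<open>0 < p\<close> \<open>0 < \<rho>\<close> by simp
      qed
    qed
  qed measurable
  moreover have "(\<integral>u. ?f u \<partial>lborel) = p * \<rho> * Gamma (real k + \<rho>) / \<mu> powr \<rho>"
  proof -
    \<comment> \<open>The power in \<open>g\<close> raises the Gamma exponent by \<open>k\<close>;
      its factor \<open>\<mu> ^ k\<close> later cancels, leaving only
      \<open>\<mu> powr \<rho>\<close>.\<close>
    have "(\<integral>u. ?f u \<partial>lborel) =
        (\<integral>u. p * \<rho> * \<mu> ^ k * (indicator {0<..} u * u powr (real k + \<rho> - 1) * exp (- (\<mu> * u))) \<partial>lborel)"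
      by (intro Bochner_Integration.integral_cong)
        (auto split: split_indicator
          simp: g_def power_mult_distrib powr_add powr_diff powr_realpow mult_ac)
    also have "\<dots> = p * \<rho> * \<mu> ^ k * (Gamma (real k + \<rho>) / \<mu> powr (real k + \<rho>))"
      using has_bochner_integral_exp_powr_Gamma[of "real k + \<rho>" \<mu>] \<open>0 < \<rho>\<close> \<open>0 < \<mu>\<close>
      by (simp add: has_bochner_integral_iff)
    also have "\<dots> = p * \<rho> * Gamma (real k + \<rho>) / \<mu> powr \<rho>"
      using \<open>0 < \<mu>\<close> by (simp add: powr_add powr_realpow)
    finally show ?thesis .
  qed
  ultimately have "((\<lambda>\<sigma>. (\<integral>u. ?F \<sigma> u \<partial>lborel) + B \<sigma> * \<sigma> powr \<rho>) \<longlongrightarrow>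
      p * \<rho> * Gamma (real k + \<rho>) / \<mu> powr \<rho>) at_top"
    using tendsto_add[OF _ B_lim] by fastforce
  then show ?thesis
    unfolding g_def[symmetric]
  proof (rule Lim_transform_eventually)
    show "\<forall>\<^sub>F \<sigma> in at_top. (\<integral>u. ?F \<sigma> u \<partial>lborel) + B \<sigma> * \<sigma> powr \<rho> =
        (\<integral>x. g (\<sigma> * h (W x)) \<partial>M) * \<sigma> powr \<rho>"
      using eventually_gt_at_top[of 0]
      by eventually_elim (simp only: A_eq[symmetric] split distrib_right)
  qed
qed

section \<open>Application to the scaling parameter\<close>

theorem lemma3p2:
  fixes M :: "'\<omega> measure" and W :: "'\<omega> \<Rightarrow> real"
    and a \<alpha> \<beta> p \<rho> b :: real and k :: nat
  assumes "prob_space M"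
    and "W \<in> borel_measurable M"
    and "\<And>x. x \<in> space M \<Longrightarrow> 0 < W x"
    and "0 \<le> a" and "1 < \<alpha>"
    and "a * \<alpha> < \<beta>"
    and "tail_regularly_varying (weight_cdf M W) \<beta>"
    and "0 < p" and "0 < \<rho>" and "0 < b"
    and "\<And>w. 0 < w \<Longrightarrow> w \<le> b \<Longrightarrow> weight_cdf M W w = p * w powr \<rho>"
  shows "((\<lambda>s. \<sigma>_param M W a k s powr \<rho> / s) \<longlongrightarrow>
           p * \<rho> / (fact k * weight_moment M W a powr \<rho>) * Gamma (real k + \<rho>)) at_top"
proof -
  let ?h = "h_fun M W a" and ?\<mu> = "weight_moment M W a"
  define G where "G \<sigma> = (\<integral>x. (\<sigma> * ?h (W x)) ^ k * exp (- (\<sigma> * ?h (W x))) \<partial>M)" for \<sigma>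
  note W = assms(1-3)
  \<comment> \<open>This places \<open>a\<close> strictly below the tail index, which yields the
    finite moment of order \<open>a\<close>.\<close>
  have "a * 1 \<le> a * \<alpha>" using assms(4,5) by (intro mult_left_mono) auto
  then have "a < \<beta>" using assms(6) by simp
  note int = integrable_powr_of_tail_regularly_varying[OF W assms(4) this assms(7)]
  note [measurable] = borel_measurable_h_fun[OF W(1,2)] W(2)
  note \<mu> = weight_moment_pos[OF W(1,3) int]
  have h_nonneg: "0 \<le> ?h w" if "0 < w" for w
    unfolding h_fun_def using that W(3)
    by (intro add_nonneg_nonneg mult_nonneg_nonneg integral_nonneg_AE AE_I2)
      (auto intro: less_imp_le)
  have "continuous_on {0<..} G"
    unfolding G_def using W h_nonneg
    by (intro continuous_on_expectation_power_exp[where X="\<lambda>x. ?h (W x)"]) auto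
  moreover have "((\<lambda>\<sigma>. G \<sigma> * \<sigma> powr \<rho>) \<longlongrightarrow> p * \<rho> * Gamma (real k + \<rho>) / ?\<mu> powr \<rho>) at_top"
    unfolding G_def
    by (rule expectation_power_exp_asymptotics[OF W assms(8-11) borel_measurable_h_fun[OF W(1,2)]
          h_fun_mono[OF W assms(4) int] h_fun_over_id_tendsto[OF W assms(4) int] \<mu>])
  moreover have "0 < p * \<rho> * Gamma (real k + \<rho>) / ?\<mu> powr \<rho>"
    using \<mu> assms(8,9) by (auto intro!: divide_pos_pos mult_pos_pos Gamma_real_pos add_nonneg_pos)
  ultimately have "((\<lambda>s. (s * (GREATEST v. fact k = s * G (s * v))) powr \<rho> / s) \<longlongrightarrow>
      p * \<rho> * Gamma (real k + \<rho>) / ?\<mu> powr \<rho> / fact k) at_top"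
    using assms(9) by (intro greatest_root_asymptotics) auto
  then show ?thesis
    by (simp add: \<sigma>_param_def v_param_def G_def field_simps)
qed

end
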